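(* Let $(\mathbb{K},|\cdot|)$ be a complete normed field and let $f\in\mathbb{K}[z]$ be a polynomial of degree $n\ge 2$ with leading coefficient $C_0$. The Dochev-Byrnev method is identical with the Prešić-Tanabe method, that is, $$\mathcal{F}(x)=\mathcal{T}(x)\quad\text{for all }x\in\mathcal{D},$$ where $\mathcal{F},\mathcal{T}\colon\mathcal{D}\subset\mathbb{K}^n\to\mathbb{K}^n$ are the iteration functions with components $$\mathcal{F}_i(x)=x_i-\frac{f(x_i)}{g'(x_i)}\left(2-\frac{f'(x_i)}{g'(x_i)}+\frac12\,\frac{f(x_i)}{g'(x_i)}\,\frac{g''(x_i)}{g'(x_i)}\right),\qquad g(z)=C_0\prod_{i=1}^n(z-x_i),$$ $$\mathcal{T}_i(x)=x_i-W_i(x)\left(1-\sum_{j\ne i}\frac{W_j(x)}{x_i-x_j}\right)\qquad(i=1,\ldots,n).$$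
   Context: A complete normed field $(\mathbb{K},|\cdot|)$ is a field with an absolute value which is complete as a metric space. $\mathcal{D}$ is the set of vectors in $\mathbb{K}^n$ with pairwise distinct components, and for $x\in\mathcal{D}$, $W_i(x)=\frac{f(x_i)}{C_0\prod_{j\ne i}(x_i-x_j)}$ ($i=1,\ldots,n$). The Dochev-Byrnev method is the iteration $x^{(k+1)}=\mathcal{F}(x^{(k)})$, $k=0,1,2,\ldots$, and the Prešić-Tanabe method is the iteration $x^{(k+1)}=\mathcal{T}(x^{(k)})$, $k=0,1,2,\ldots$.
   Formalization: The field is assumed to have characteristic different from 2, because the factor 1/2 in the formula for the Dochev-Byrnev iteration function has no meaning in characteristic 2. *)

theory Defs
  imports "HOL-Analysis.Analysis" "HOL-Computational_Algebra.Polynomial"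
begin

(* The library classes of normed fields (real_normed_field and its subclasses) only cover real
   algebras; a general absolute value (for instance a p-adic one) is therefore given as an
   explicit function. The trivial absolute value is allowed. *)

locale normed_field =
  fixes absv :: "'a::field \<Rightarrow> real"
  assumes absv_nonneg: "0 \<le> absv x"
    and absv_eq_0_iff: "absv x = 0 \<longleftrightarrow> x = 0"
    and absv_mult: "absv (x * y) = absv x * absv y"
    and absv_triangle: "absv (x + y) \<le> absv x + absv y"
begin

lemma absv_minus_commute: "absv (x - y) = absv (y - x)"
proof -
  have "absv (-1) * absv (-1) = absv 1" "absv 1 * absv 1 = absv 1"
    using absv_mult[of "-1" "-1"] absv_mult[of 1 1] by simp_all
  moreover have "absv 1 \<noteq> 0"
    using absv_eq_0_iff by simp
  ultimately have "(absv (-1))\<^sup>2 = 1"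
    by (simp add: power2_eq_square)
  then have "absv (-1) = 1"
    using absv_nonneg[of "-1"] by (simp add: power2_eq_1_iff)
  then show ?thesis
    using absv_mult[of "-1" "x - y"] by simp
qed

end

sublocale normed_field \<subseteq> Metric_space UNIV "\<lambda>x y. absv (x - y)"
proof
  show "absv (x - z) \<le> absv (x - y) + absv (y - z)" for x y z
    using absv_triangle[of "x - y" "y - z"] by simp
qed (auto simp: absv_nonneg absv_eq_0_iff intro: absv_minus_commute)

locale complete_normed_field = normed_field +
  assumes complete: mcomplete

definition distinct_vecs :: "('a ^ 'n) set" where
  "distinct_vecs = {x. inj (\<lambda>i. x $ i)}"

definition weierstrass_correction ::
    "'a::field poly \<Rightarrow> 'a ^ 'n \<Rightarrow> 'n::finite \<Rightarrow> 'a" where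
  "weierstrass_correction f x i =
     poly f (x $ i) / (lead_coeff f * (\<Prod>j \<in> UNIV - {i}. x $ i - x $ j))"

definition node_poly :: "'a::field poly \<Rightarrow> 'a ^ 'n::finite \<Rightarrow> 'a poly" where
  "node_poly f x = smult (lead_coeff f) (\<Prod>i \<in> UNIV. [:- (x $ i), 1:])"

(* The two iteration functions are meant on distinct_vecs, where no divisor except possibly 2
   vanishes; elsewhere they have junk values (x / 0 = 0). *)

definition dochev_byrnev :: "'a::field poly \<Rightarrow> 'a ^ 'n::finite \<Rightarrow> 'a ^ 'n" where
  "dochev_byrnev f x =
     (let g = node_poly f x; g' = pderiv g; g'' = pderiv g'; f' = pderiv f in
      \<chi> i. x $ i - poly f (x $ i) / poly g' (x $ i) *
        (2 - poly f' (x $ i) / poly g' (x $ i)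
           + 1 / 2 * (poly f (x $ i) / poly g' (x $ i)) * (poly g'' (x $ i) / poly g' (x $ i))))"

definition presic_tanabe :: "'a::field poly \<Rightarrow> 'a ^ 'n::finite \<Rightarrow> 'a ^ 'n" where
  "presic_tanabe f x =
     (\<chi> i. x $ i - weierstrass_correction f x i *
        (1 - (\<Sum>j \<in> UNIV - {i}. weierstrass_correction f x j / (x $ i - x $ j))))"

end

theory Submission
  imports Defs
begin

text \<open>
  Lagrange interpolation at the nodes gives
  \<open>f = g + C\<^sub>0 \<Sum>\<^sub>j W\<^sub>j \<Prod>\<^sub>k\<^sub>\<noteq>\<^sub>j (z - x\<^sub>k)\<close>, because both sides have the same leading
  term and agree at the \<open>n\<close> nodes. With \<open>S = \<Sum>\<^sub>j\<^sub>\<noteq>\<^sub>i 1 / (x\<^sub>i - x\<^sub>j)\<close>, differentiating at \<open>x\<^sub>i\<close>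
  yields \<open>f' / g' = 1 + W\<^sub>i S + \<Sum>\<^sub>j\<^sub>\<noteq>\<^sub>i W\<^sub>j / (x\<^sub>i - x\<^sub>j)\<close>, and \<open>g'' / g' = 2 S\<close>,
  so the terms \<open>W\<^sub>i S\<close> cancel in the Dochev-Byrnev correction.
\<close>

lemma poly_prod_linear:
  fixes a :: "'i \<Rightarrow> 'a::comm_ring_1"
  shows "poly (\<Prod>k\<in>A. [:- a k, 1:]) z = (\<Prod>k\<in>A. z - a k)"
  by (simp add: poly_prod)

lemma monic_prod_linear:
  fixes a :: "'i \<Rightarrow> 'a::idom"
  shows "lead_coeff (\<Prod>k\<in>A. [:- a k, 1:]) = 1"
  by (simp add: lead_coeff_prod)

lemma degree_prod_linear:
  fixes a :: "'i \<Rightarrow> 'a::idom"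
  assumes "finite A"
  shows "degree (\<Prod>k\<in>A. [:- a k, 1:]) = card A"
  by (subst degree_prod_eq_sum_degree) auto

text \<open>Split off the factor \<open>z - a i\<close>: in the product rule, the term that keeps
  this factor vanishes at \<open>a i\<close>.\<close>

lemma poly_pderiv_prod_linear_node:
  fixes a :: "'i \<Rightarrow> 'a::idom"
  assumes "finite A" "i \<in> A"
  shows "poly (pderiv (\<Prod>k\<in>A. [:- a k, 1:])) (a i) = (\<Prod>k\<in>A - {i}. a i - a k)"
  by (simp add: prod.remove[OF assms] pderiv_mult pderiv_pCons poly_prod_linear del: mult_pCons_left)

text \<open>With the product written as \<open>(z - a i) * Q\<close>, its second derivative is
  \<open>2 * Q' + (z - a i) * Q''\<close>, and the last term vanishes at \<open>a i\<close>.\<close>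

lemma poly_pderiv2_prod_linear_node:
  fixes a :: "'i \<Rightarrow> 'a::idom"
  assumes "finite A" "i \<in> A"
  shows "poly (pderiv (pderiv (\<Prod>k\<in>A. [:- a k, 1:]))) (a i) =
    2 * poly (pderiv (\<Prod>k\<in>A - {i}. [:- a k, 1:])) (a i)"
  by (simp add: prod.remove[OF assms] pderiv_mult pderiv_add pderiv_pCons del: mult_pCons_left)

text \<open>This is the logarithmic derivative; away from the nodes, omitting a factor amounts to
  dividing by it.\<close>

lemma poly_pderiv_prod_linear:
  fixes a :: "'i \<Rightarrow> 'a::field"
  assumes "finite B" "\<And>j. j \<in> B \<Longrightarrow> z \<noteq> a j"
  shows "poly (pderiv (\<Prod>k\<in>B. [:- a k, 1:])) z =
    (\<Prod>k\<in>B. z - a k) * (\<Sum>j\<in>B. 1 / (z - a j))"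
proof -
  have "(\<Prod>k\<in>B - {j}. z - a k) = (\<Prod>k\<in>B. z - a k) * (1 / (z - a j))" if "j \<in> B" for j
    using that assms(2)[OF that] by (simp add: prod.remove[OF assms(1) that])
  then show ?thesis
    by (simp add: pderiv_prod poly_sum poly_prod_linear pderiv_pCons sum_distrib_left
        del: mult_pCons_left)
qed

lemma pderiv_sum: "pderiv (\<Sum>j\<in>A. p j) = (\<Sum>j\<in>A. pderiv (p j))"
  by (induction A rule: infinite_finite_induct) (auto simp: pderiv_add)

lemma lagrange_interpolation:
  fixes a :: "'i \<Rightarrow> 'a::field"
  assumes fin: "finite A" and inj: "inj_on a A" and deg: "degree f = card A"
  shows "f = smult (lead_coeff f) (\<Prod>k\<in>A. [:- a k, 1:]) +
    (\<Sum>j\<in>A. smult (poly f (a j) / (\<Prod>k\<in>A - {j}. a j - a k)) (\<Prod>k\<in>A - {j}. [:- a k, 1:]))"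
    (is "f = ?q + (\<Sum>j\<in>A. ?r j)")
\<comment> \<open>The two sides have equal coefficients at \<open>card A\<close>, so
  \<open>card A\<close> common values suffice instead of \<open>card A + 1\<close>.\<close>
proof (rule poly_eqI_degree_lead_coeff[where A = "a ` A" and n = "card A"])
  have deg_r: "degree (?r j) < card A" if "j \<in> A" for j
  proof -
    have "degree (?r j) \<le> card (A - {j})"
      using degree_smult_le degree_prod_linear[of "A - {j}" a] fin by (metis finite_Diff)
    also have "\<dots> < card A"
      using fin that by (rule card_Diff1_less)
    finally show ?thesis .
  qed
  have deg_q: "degree ?q \<le> card A"
    using degree_smult_le degree_prod_linear[OF fin] by metis
  have "degree (\<Sum>j\<in>A. ?r j) \<le> card A"
    by (rule degree_sum_le[OF fin less_imp_le[OF deg_r]])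
  with deg_q show "degree (?q + (\<Sum>j\<in>A. ?r j)) \<le> card A"
    by (rule degree_add_le)
  have "coeff (\<Sum>j\<in>A. ?r j) (card A) = 0"
    using deg_r by (auto simp: coeff_sum simp del: coeff_smult intro!: sum.neutral coeff_eq_0)
  then show "coeff f (card A) = coeff (?q + (\<Sum>j\<in>A. ?r j)) (card A)"
    using monic_prod_linear[of a A] by (simp add: degree_prod_linear[OF fin] deg)
  show "card (a ` A) \<ge> card A"
    by (simp add: card_image[OF inj])
  show "degree f \<le> card A"
    by (simp add: deg)
  fix z assume "z \<in> a ` A"
  then obtain i where i: "i \<in> A" and z: "z = a i"
    by blast
  have nz: "(\<Prod>k\<in>A - {i}. a i - a k) \<noteq> 0"
    using inj i fin by (auto dest: inj_onD)
  \<comment> \<open>For \<open>j\<close> other than \<open>i\<close>, the product in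
    \<open>?r j\<close> still contains the factor that vanishes at \<open>a i\<close>.\<close>
  have "(\<Sum>j\<in>A. poly (?r j) z) = poly (?r i) z"
    using i fin by (simp add: z sum.remove[OF fin i])
      (auto simp: poly_prod_linear intro!: sum.neutral)
  moreover have "poly ?q z = 0"
    using i fin by (auto simp: z poly_prod_linear)
  ultimately show "poly f z = poly (?q + (\<Sum>j\<in>A. ?r j)) z"
    using nz by (simp add: poly_sum poly_prod_linear z)
qed

theorem theorem4p1:
  fixes absv :: "'a::field \<Rightarrow> real" and f :: "'a poly"
  assumes "complete_normed_field absv"
    and "(2::'a) \<noteq> 0"
    and "degree f = CARD('n::finite)" and "CARD('n) \<ge> 2"
  shows "\<forall>x \<in> (distinct_vecs :: ('a ^ 'n) set). dochev_byrnev f x = presic_tanabe f x"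
proof
  fix x :: "'a ^ 'n"
  assume "x \<in> distinct_vecs"
  then have inj: "inj (($) x)"
    by (simp add: distinct_vecs_def)
  define C where "C = lead_coeff f"
  define W where "W = weierstrass_correction f x"
  define D where "D i = (\<Prod>k\<in>UNIV - {i}. x $ i - x $ k)" for i
  define P where "P A = (\<Prod>k\<in>A. [:- (x $ k), 1:])" for A
  define g where "g = node_poly f x"
  have C: "C \<noteq> 0"
    using assms(3,4) unfolding C_def leading_coeff_0_iff by auto
  have ne: "x $ i \<noteq> x $ j" if "j \<noteq> i" for i j
    using inj that by (auto dest: injD)
  have D: "D i \<noteq> 0" for i
    using ne by (auto simp: D_def)
  have W: "poly f (x $ i) = C * W i * D i" for i
    using C D[of i] by (simp add: W_def weierstrass_correction_def flip: C_def D_def)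
  have g: "g = smult C (P UNIV)"
    by (simp add: g_def node_poly_def C_def P_def)
  \<comment> \<open>By \<open>W\<close>, the Lagrange coefficient
    \<open>poly f (x $ j) / D j\<close> equals \<open>C * W j\<close>.\<close>
  have f: "f = g + (\<Sum>j\<in>UNIV. smult (C * W j) (P (UNIV - {j})))"
    using lagrange_interpolation[of UNIV "($) x" f, folded P_def D_def C_def] inj assms(3) D
    by (simp add: W g)
  have "dochev_byrnev f x $ i = presic_tanabe f x $ i" for i
  proof -
    define S where "S = (\<Sum>j\<in>UNIV - {i}. 1 / (x $ i - x $ j))"
    define T where "T = (\<Sum>j\<in>UNIV - {i}. W j / (x $ i - x $ j))"
    have g': "poly (pderiv g) (x $ i) = C * D i"
      by (simp add: g pderiv_smult P_def D_def poly_pderiv_prod_linear_node)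
    have P': "poly (pderiv (P (UNIV - {i}))) (x $ i) = D i * S"
      unfolding P_def D_def S_def by (rule poly_pderiv_prod_linear) (use ne in auto)
    have g'': "poly (pderiv (pderiv g)) (x $ i) = C * (2 * (D i * S))"
      using P' by (simp add: g pderiv_smult P_def poly_pderiv2_prod_linear_node)
    \<comment> \<open>Omitting node \<open>j\<close> leaves \<open>x $ i\<close> among the roots, so
      the derivative there is \<open>D i\<close> without its factor
      \<open>x $ i - x $ j\<close>.\<close>
    have "poly (pderiv (P (UNIV - {j}))) (x $ i) = D i / (x $ i - x $ j)" if "j \<noteq> i" for j
    proof -
      have "poly (pderiv (P (UNIV - {j}))) (x $ i) = (\<Prod>k\<in>UNIV - {j} - {i}. x $ i - x $ k)"
        unfolding P_def by (rule poly_pderiv_prod_linear_node) (use that in auto)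
      moreover have "D i = (x $ i - x $ j) * (\<Prod>k\<in>UNIV - {i} - {j}. x $ i - x $ k)"
        unfolding D_def by (rule prod.remove) (use that in auto)
      moreover have "UNIV - {j} - {i} = UNIV - {i} - {j}"
        by blast
      ultimately show ?thesis
        using ne[OF that] by simp
    qed
    then have "(\<Sum>j\<in>UNIV - {i}. C * W j * poly (pderiv (P (UNIV - {j}))) (x $ i)) = C * D i * T"
      by (auto simp: T_def sum_distrib_left intro!: sum.cong)
    moreover have "poly (pderiv f) (x $ i) = poly (pderiv g) (x $ i) +
        (\<Sum>j\<in>UNIV. C * W j * poly (pderiv (P (UNIV - {j}))) (x $ i))"
      by (subst f) (simp add: pderiv_add pderiv_sum pderiv_smult poly_sum)
    \<comment> \<open>The summand \<open>j = i\<close> is separated because its product omits the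
      node \<open>x $ i\<close>; by \<open>P'\<close> it contributes the term with
      \<open>S\<close>.\<close>
    ultimately have f': "poly (pderiv f) (x $ i) = C * D i * (1 + W i * S + T)"
      by (simp add: sum.remove[of UNIV i] g' P' algebra_simps)
    have "poly f (x $ i) / poly (pderiv g) (x $ i) = W i"
      using C D[of i] by (simp add: W g')
    moreover have "poly (pderiv f) (x $ i) / poly (pderiv g) (x $ i) = 1 + W i * S + T"
      using C D[of i] by (simp add: f' g')
    moreover have "poly (pderiv (pderiv g)) (x $ i) / poly (pderiv g) (x $ i) = 2 * S"
      using C D[of i] by (simp add: g' g'')
    ultimately have "dochev_byrnev f x $ i =
        x $ i - W i * (2 - (1 + W i * S + T) + 1 / 2 * W i * (2 * S))"
      by (simp only: dochev_byrnev_def Let_def vec_lambda_beta flip: g_def)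
    \<comment> \<open>Here \<open>2 \<noteq> 0\<close> enters: in characteristic 2 the factor
      \<open>1 / 2\<close> would be \<open>1 / 0 = 0\<close>. The resulting \<open>W i * S\<close>
      cancels the one coming from \<open>f'\<close>.\<close>
    also have "1 / 2 * W i * (2 * S) = W i * S"
      using assms(2) by simp
    finally show ?thesis
      by (simp add: presic_tanabe_def flip: W_def T_def)
  qed
  then show "dochev_byrnev f x = presic_tanabe f x"
    by (simp add: vec_eq_iff)
qed

end
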